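(* There exists a class $\mathcal{C}$ of infinite left-r.e. reals such that $\{e:\alpha_e\in\mathcal{C}\}$ is a $\Sigma_3$ set for every universal left-r.e. numbering $\alpha$, $\mathcal{C}$ contains no shift-persistent element, and $\mathcal{C}$ has no left-r.e. numbering.
   Context: Reals are infinite binary sequences, identified with numbers in $[0,1]$. A real is left-r.e. if it is the limit of a recursive nondecreasing sequence of rationals; it is infinite if its binary expansion has infinitely many 0's and infinitely many 1's. $X$ is a shift-persistent element of $\mathcal{C}$ if $\sigma^\frown X\in\mathcal{C}$ for every finite binary string $\sigma$. A left-r.e. numbering is a map $e\mapsto\alpha_e=\sum_{x\in\operatorname{dom}\varphi_e}2^{-|x|}$ (with $|x|=\lceil\log(x+1)\rceil$) for some partial recursive $\langle e,x\rangle\mapsto\varphi_e(x)$; it is a numbering of $\mathcal{C}$ if its range is exactly $\mathcal{C}$, and universal if its range is all left-r.e. reals. *)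

theory Defs
  imports Complex_Main "HOL-Library.Stream" "HOL-Analysis.Infinite_Sum"
begin

section \<open>Partial recursive functions\<close>

text \<open>
  Kleene's schemes. The arity is not part of a term: a term applied to an argument
  list of unsuitable length has no value there. In primitive recursion and in
  minimisation the distinguished variable is the first argument.
\<close>

datatype recf =
    Zero
  | Succ
  | Proj nat
  | Comp recf "recf list"
  | PrimRec recf recf
  | Mu recf

inductive computes :: "recf \<Rightarrow> nat list \<Rightarrow> nat \<Rightarrow> bool" where
  zero: "computes Zero xs 0"
| succ: "computes Succ [x] (Suc x)"
| proj: "i < length xs \<Longrightarrow> computes (Proj i) xs (xs ! i)"
| comp: "\<lbrakk>length ys = length gs; \<forall>i<length gs. computes (gs ! i) xs (ys ! i); computes f ys z\<rbrakk>
    \<Longrightarrow> computes (Comp f gs) xs z"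
| primrec_0: "computes f xs y \<Longrightarrow> computes (PrimRec f g) (0 # xs) y"
| primrec_Suc: "\<lbrakk>computes (PrimRec f g) (n # xs) y; computes g (n # y # xs) z\<rbrakk>
    \<Longrightarrow> computes (PrimRec f g) (Suc n # xs) z"
| mu: "\<lbrakk>computes f (n # xs) 0; \<forall>m<n. \<exists>y>0. computes f (m # xs) y\<rbrakk>
    \<Longrightarrow> computes (Mu f) xs n"

definition partial_recursive :: "nat \<Rightarrow> (nat list \<Rightarrow> nat option) \<Rightarrow> bool" where
  "partial_recursive k \<phi> \<longleftrightarrow>
    (\<exists>f. \<forall>xs. length xs = k \<longrightarrow> (\<forall>y. \<phi> xs = Some y \<longleftrightarrow> computes f xs y))"

definition recursive :: "nat \<Rightarrow> (nat list \<Rightarrow> nat) \<Rightarrow> bool" where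
  "recursive k f \<longleftrightarrow> partial_recursive k (\<lambda>xs. Some (f xs))"

definition recursive_rel :: "nat \<Rightarrow> (nat list \<Rightarrow> bool) \<Rightarrow> bool" where
  "recursive_rel k R \<longleftrightarrow> recursive k (\<lambda>xs. of_bool (R xs))"

definition Sigma3 :: "nat set \<Rightarrow> bool" where
  "Sigma3 A \<longleftrightarrow>
    (\<exists>R. recursive_rel 4 R \<and> (\<forall>e. e \<in> A \<longleftrightarrow> (\<exists>a. \<forall>b. \<exists>c. R [e, a, b, c])))"

section \<open>Reals in the unit interval\<close>

definition binary_value :: "bool stream \<Rightarrow> real" where
  "binary_value X = (\<Sum>n. of_bool (X !! n) / 2 ^ Suc n)"

text \<open>
  Infinite binary sequences are identified with the numbers they denote. Only dyadic
  rationals have two expansions, and neither of these has both infinitely many 0's and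
  infinitely many 1's; prefixing a string to either of them yields the same number.
\<close>

definition infinite_real :: "real \<Rightarrow> bool" where
  "infinite_real x \<longleftrightarrow>
    (\<exists>X. binary_value X = x \<and> infinite {n. \<not> X !! n} \<and> infinite {n. X !! n})"

definition shift_persistent :: "real set \<Rightarrow> real \<Rightarrow> bool" where
  "shift_persistent \<C> x \<longleftrightarrow>
    x \<in> \<C> \<and> (\<exists>X. binary_value X = x \<and> (\<forall>\<sigma> :: bool list. binary_value (\<sigma> @- X) \<in> \<C>))"

definition recursive_rat_seq :: "(nat \<Rightarrow> rat) \<Rightarrow> bool" where
  "recursive_rat_seq q \<longleftrightarrow>
    (\<exists>a b c. recursive 1 (\<lambda>xs. a (xs ! 0)) \<and> recursive 1 (\<lambda>xs. b (xs ! 0)) \<and>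
       recursive 1 (\<lambda>xs. c (xs ! 0)) \<and>
       (\<forall>n. q n = (of_nat (a n) - of_nat (b n)) / of_nat (Suc (c n))))"

definition left_re :: "real \<Rightarrow> bool" where
  "left_re x \<longleftrightarrow> x \<in> {0..1} \<and>
    (\<exists>q. recursive_rat_seq q \<and> mono q \<and> (\<lambda>n. real_of_rat (q n)) \<longlonglongrightarrow> x)"

section \<open>Left-r.e. numberings\<close>

definition len :: "nat \<Rightarrow> nat" where
  "len x = nat \<lceil>log 2 (real x + 1)\<rceil>"

text \<open>
  The weights of all natural numbers sum up to infinity, so the requirement that every
  value is a real in the unit interval is a restriction on \<open>\<phi>\<close>.
\<close>

definition left_re_numbering :: "(nat \<Rightarrow> real) \<Rightarrow> bool" where
  "left_re_numbering \<alpha> \<longleftrightarrow>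
    (\<exists>\<phi> :: nat \<Rightarrow> nat \<Rightarrow> nat option.
       partial_recursive 2 (\<lambda>xs. \<phi> (xs ! 0) (xs ! 1)) \<and>
       (\<forall>e. \<alpha> e \<in> {0..1} \<and> ((\<lambda>x. 1 / 2 ^ len x) has_sum \<alpha> e) (dom (\<phi> e))))"

definition left_re_numbering_of :: "(nat \<Rightarrow> real) \<Rightarrow> real set \<Rightarrow> bool" where
  "left_re_numbering_of \<alpha> \<C> \<longleftrightarrow> left_re_numbering \<alpha> \<and> range \<alpha> = \<C>"

definition universal_left_re_numbering :: "(nat \<Rightarrow> real) \<Rightarrow> bool" where
  "universal_left_re_numbering \<alpha> \<longleftrightarrow> left_re_numbering_of \<alpha> {x. left_re x}"

end

theory Submission imports Defs begin

text \<open>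
  Let \<open>x\<^sub>n = 2 ^ -n / 3\<close>. The class consists of the \<open>x\<^sub>n\<close> with \<open>n \<in> A\<close>, where \<open>A\<close> is \<open>\<Pi>\<^sub>2\<close> but not \<open>\<Sigma>\<^sub>2\<close>.
  Membership of \<open>\<alpha>\<^sub>e\<close> is then \<open>\<Sigma>\<^sub>3\<close>, because \<open>\<alpha>\<^sub>e = x\<^sub>n\<close> is a \<open>\<Pi>\<^sub>2\<close> condition. All members are at most \<open>1/3\<close>,
  so prefixing the digit 1 leaves the class. A numbering \<open>\<beta>\<close> of the class would make \<open>A\<close> a \<open>\<Sigma>\<^sub>2\<close> set, since
  \<open>n \<in> A\<close> iff \<open>x\<^sub>n\<^sub>+\<^sub>1 < \<beta>\<^sub>e \<le> x\<^sub>n\<close> for some \<open>e\<close>. To obtain \<open>A\<close> without a universal machine,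
  diagonalise against a universal left-r.e. numbering \<open>\<alpha>\<close>: the complement of a \<open>\<Sigma>\<^sub>2\<close> set has the form
  \<open>{n. \<forall>a. (n, a) \<in> B}\<close> with \<open>B\<close> r.e., and \<open>B\<close> can be coded into the digits of a left-r.e. real \<open>\<alpha>\<^sub>n\<close>;
  the digits of \<open>\<alpha>\<^sub>n\<close> are limits of recursive approximations, so \<open>A = {n. \<forall>a. digit (n, a) of \<alpha>\<^sub>n says yes}\<close>
  is \<open>\<Pi>\<^sub>2\<close> and differs from every \<open>\<Sigma>\<^sub>2\<close> set.
\<close>

section \<open>Closure properties of recursive functions\<close>

lemma computes_deterministic:
  "computes f xs y \<Longrightarrow> computes f xs z \<Longrightarrow> y = z"
proof (induction arbitrary: z rule: computes.induct)
  case (comp ys gs xs f y)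
  from comp.prems obtain ys' where ys': "length ys' = length gs"
    "\<forall>i<length gs. computes (gs ! i) xs (ys' ! i)" "computes f ys' z"
    by cases auto
  have "ys = ys'"
    by (rule nth_equalityI) (use comp.hyps comp.IH ys' in auto)
  with comp.IH ys' show ?case by blast
next
  case (primrec_Suc f g n xs y w)
  from primrec_Suc.prems obtain y' where "computes (PrimRec f g) (n # xs) y'" "computes g (n # y' # xs) z"
    by cases auto
  with primrec_Suc.IH show ?case by blast
next
  case (mu f n xs)
  from mu.prems have z: "computes f (z # xs) 0" "\<forall>m<z. \<exists>y>0. computes f (m # xs) y"
    by (cases, auto)+
  show ?case
  proof (cases n z rule: linorder_cases)
    case less
    with z(2) mu.IH(1) show ?thesis by (metis less_irrefl)
  next
    case greater
    with z(1) mu.IH(2) show ?thesis by (metis less_irrefl)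
  qed
next
  case (proj i xs)
  from proj.prems show ?case by cases auto
next
  case (primrec_0 f xs y g)
  from primrec_0.prems primrec_0.IH show ?case by cases auto
next
  case (zero xs)
  then show ?case by cases auto
next
  case (succ x)
  then show ?case by cases auto
qed

text \<open>By determinism a program that yields the right value yields no other, so one implication
  suffices for the equivalence in \<open>partial_recursive\<close>.\<close>

lemma recursive_iff_computes:
  "recursive k F \<longleftrightarrow> (\<exists>f. \<forall>xs. length xs = k \<longrightarrow> computes f xs (F xs))"
  unfolding recursive_def partial_recursive_def using computes_deterministic by blast

lemma recursive_cong:
  assumes "recursive k G" "\<And>xs. length xs = k \<Longrightarrow> F xs = G xs"
  shows "recursive k F"
  using assms unfolding recursive_iff_computes by auto

lemma recursive_list_comp:
  assumes "recursive (length Gs) F" "\<forall>G\<in>set Gs. recursive k G"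
  shows "recursive k (\<lambda>xs. F (map (\<lambda>G. G xs) Gs))"
proof -
  obtain f where f: "\<And>xs. length xs = length Gs \<Longrightarrow> computes f xs (F xs)"
    using assms(1) unfolding recursive_iff_computes by blast
  have "\<forall>G\<in>set Gs. \<exists>g. \<forall>xs. length xs = k \<longrightarrow> computes g xs (G xs)"
    using assms(2) unfolding recursive_iff_computes by blast
  then obtain h where h: "\<And>G xs. G \<in> set Gs \<Longrightarrow> length xs = k \<Longrightarrow> computes (h G) xs (G xs)"
    by metis
  have "computes (Comp f (map h Gs)) xs (F (map (\<lambda>G. G xs) Gs))" if "length xs = k" for xs
    by (rule computes.comp[where ys = "map (\<lambda>G. G xs) Gs"]) (use f h that in auto)
  then show ?thesis unfolding recursive_iff_computes by blast
qed

lemma recursive_comp1: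
  assumes "recursive 1 (\<lambda>xs. f (xs ! 0))" "recursive k g"
  shows "recursive k (\<lambda>xs. f (g xs))"
  using recursive_list_comp[where Gs = "[g]" and k = k, of "\<lambda>xs. f (xs ! 0)"] assms by simp

lemma recursive_comp2:
  assumes "recursive 2 (\<lambda>xs. f (xs ! 0) (xs ! 1))" "recursive k g" "recursive k h"
  shows "recursive k (\<lambda>xs. f (g xs) (h xs))"
  using recursive_list_comp[where Gs = "[g, h]" and k = k, of "\<lambda>xs. f (xs ! 0) (xs ! 1)"] assms
  by (auto simp: numeral_2_eq_2)

lemma recursive_nth: "i < k \<Longrightarrow> recursive k (\<lambda>xs. xs ! i)"
  unfolding recursive_iff_computes by (metis computes.proj)

text \<open>The schemes below put a bound variable in front of the parameters, so bodies arrive in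
  terms of \<open>hd\<close> and \<open>tl\<close>; such accesses are projections.\<close>

lemma recursive_hd: "0 < k \<Longrightarrow> recursive k hd"
  by (rule recursive_cong[OF recursive_nth[of 0]]) (auto simp: hd_conv_nth)

lemma recursive_hd_tl: "1 < k \<Longrightarrow> recursive k (\<lambda>xs. hd (tl xs))"
  by (rule recursive_cong[OF recursive_nth[of 1]])
    (auto simp: hd_conv_nth nth_tl simp flip: length_greater_0_conv)

lemma recursive_hd_tl_tl: "2 < k \<Longrightarrow> recursive k (\<lambda>xs. hd (tl (tl xs)))"
  by (rule recursive_cong[OF recursive_nth[of 2]])
    (auto simp: hd_conv_nth nth_tl numeral_2_eq_2 simp flip: length_greater_0_conv)

lemma recursive_nth_tl: "Suc i < k \<Longrightarrow> recursive k (\<lambda>xs. tl xs ! i)"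
  by (rule recursive_cong[OF recursive_nth[of "Suc i"]]) (auto simp: nth_tl)

lemma recursive_nth_tl_tl: "Suc (Suc i) < k \<Longrightarrow> recursive k (\<lambda>xs. tl (tl xs) ! i)"
  by (rule recursive_cong[OF recursive_nth[of "Suc (Suc i)"]]) (auto simp: nth_tl)

lemma recursive_Suc:
  assumes "recursive k f" shows "recursive k (\<lambda>xs. Suc (f xs))"
proof (rule recursive_comp1[OF _ assms])
  have "computes Succ xs (Suc (xs ! 0))" if "length xs = 1" for xs
    using that computes.succ by (cases xs) auto
  then show "recursive 1 (\<lambda>xs. Suc (xs ! 0))" unfolding recursive_iff_computes by blast
qed

lemma recursive_const: "recursive k (\<lambda>xs. c)"
proof (induction c)
  case 0
  then show ?case unfolding recursive_iff_computes using computes.zero by blast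
qed (rule recursive_Suc)

lemma recursive_rec_nat:
  assumes h: "recursive k h" and f: "recursive k f"
    and g: "recursive (Suc (Suc k)) (\<lambda>xs. g (hd xs) (hd (tl xs)) (tl (tl xs)))"
  shows "recursive k (\<lambda>xs. rec_nat (f xs) (\<lambda>n y. g n y xs) (h xs))"
proof -
  obtain cf where cf: "\<And>xs. length xs = k \<Longrightarrow> computes cf xs (f xs)"
    using f unfolding recursive_iff_computes by blast
  obtain cg where cg: "\<And>xs. length xs = Suc (Suc k) \<Longrightarrow> computes cg xs (g (hd xs) (hd (tl xs)) (tl (tl xs)))"
    using g unfolding recursive_iff_computes by blast
  obtain ch where ch: "\<And>xs. length xs = k \<Longrightarrow> computes ch xs (h xs)"
    using h unfolding recursive_iff_computes by blast
  have rec: "computes (PrimRec cf cg) (n # xs) (rec_nat (f xs) (\<lambda>n y. g n y xs) n)"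
    if "length xs = k" for n xs
  proof (induction n)
    case 0
    show ?case using cf[OF that] by (simp add: computes.primrec_0)
  next
    case (Suc n)
    show ?case
      using computes.primrec_Suc[OF Suc] cg[of "n # rec_nat (f xs) (\<lambda>n y. g n y xs) n # xs"] that
      by simp
  qed
  \<comment> \<open>\<open>PrimRec\<close> recurses on its first argument, so \<open>h xs\<close> is
    put in front and projections pass on the k parameters.\<close>
  have "computes (Comp (PrimRec cf cg) (ch # map Proj [0..<k])) xs
      (rec_nat (f xs) (\<lambda>n y. g n y xs) (h xs))" if "length xs = k" for xs
  proof (rule computes.comp[where ys = "h xs # xs"])
    show "\<forall>i<length (ch # map Proj [0..<k]).
        computes ((ch # map Proj [0..<k]) ! i) xs ((h xs # xs) ! i)"
      using that ch computes.proj by (auto simp: nth_Cons split: nat.split)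
  qed (use that rec in auto)
  then show ?thesis unfolding recursive_iff_computes by blast
qed

lemmas recursive_atoms = recursive_nth recursive_hd recursive_hd_tl recursive_hd_tl_tl
  recursive_nth_tl recursive_nth_tl_tl recursive_const recursive_Suc

text \<open>Serves to rearrange bound variables in front of a parameter list whose length k is
  itself a variable.\<close>

lemma recursive_comp_drop:
  assumes F: "recursive (length Gs + k) F" and G: "\<forall>G\<in>set Gs. recursive (n + k) G"
  shows "recursive (n + k) (\<lambda>xs. F (map (\<lambda>G. G xs) Gs @ drop n xs))"
proof -
  have "recursive (n + k) (\<lambda>xs. F (map (\<lambda>G. G xs) (Gs @ map (\<lambda>i xs. xs ! (n + i)) [0..<k])))"
    by (rule recursive_list_comp) (use assms in \<open>auto intro: recursive_nth\<close>)
  then show ?thesis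
  proof (rule recursive_cong)
    fix xs :: "nat list" assume l: "length xs = n + k"
    have "map (\<lambda>i. xs ! (n + i)) [0..<k] = drop n xs"
      by (rule nth_equalityI) (use l in auto)
    then show "F (map (\<lambda>G. G xs) Gs @ drop n xs)
        = F (map (\<lambda>G. G xs) (Gs @ map (\<lambda>i xs. xs ! (n + i)) [0..<k]))"
      by (simp add: comp_def)
  qed
qed

lemma recursive_add:
  assumes "recursive k f" "recursive k g" shows "recursive k (\<lambda>xs. f xs + g xs)"
proof (rule recursive_comp2[OF _ assms])
  have "recursive 2 (\<lambda>xs. rec_nat (xs ! 0) (\<lambda>n y. Suc y) (xs ! 1))"
    by (intro recursive_rec_nat recursive_atoms) auto
  moreover have "rec_nat m (\<lambda>n y. Suc y) n = m + n" for m n by (induction n) auto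
  ultimately show "recursive 2 (\<lambda>xs. xs ! 0 + xs ! 1)" by simp
qed

lemma recursive_mult:
  assumes "recursive k f" "recursive k g" shows "recursive k (\<lambda>xs. f xs * g xs)"
proof (rule recursive_comp2[OF _ assms])
  have "recursive 2 (\<lambda>xs. rec_nat 0 (\<lambda>n y. y + xs ! 0) (xs ! 1))"
    by (intro recursive_rec_nat recursive_add recursive_atoms) auto
  moreover have "rec_nat 0 (\<lambda>n y. y + m) n = m * n" for m n :: nat by (induction n) auto
  ultimately show "recursive 2 (\<lambda>xs. xs ! 0 * xs ! 1)" by simp
qed

lemma recursive_power:
  assumes "recursive k f" "recursive k g" shows "recursive k (\<lambda>xs. f xs ^ g xs)"
proof (rule recursive_comp2[OF _ assms])
  have "recursive 2 (\<lambda>xs. rec_nat 1 (\<lambda>n y. y * xs ! 0) (xs ! 1))"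
    by (intro recursive_rec_nat recursive_mult recursive_atoms) auto
  moreover have "rec_nat 1 (\<lambda>n y. y * m) n = m ^ n" for m n :: nat by (induction n) auto
  ultimately show "recursive 2 (\<lambda>xs. xs ! 0 ^ xs ! 1)" by simp
qed

lemma recursive_diff:
  assumes "recursive k f" "recursive k g" shows "recursive k (\<lambda>xs. f xs - g xs)"
proof (rule recursive_comp2[OF _ assms])
  \<comment> \<open>The predecessor is a recursion returning the index of its last step; truncated
    subtraction iterates it.\<close>
  have "recursive 1 (\<lambda>xs. rec_nat 0 (\<lambda>n y. n) (xs ! 0))"
    by (intro recursive_rec_nat recursive_atoms) auto
  moreover have "rec_nat 0 (\<lambda>n y. n) n = n - 1" for n :: nat by (cases n) auto
  ultimately have "recursive 1 (\<lambda>xs. xs ! 0 - 1)" by simp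
  note pred = recursive_comp1[where f = "\<lambda>y. y - 1", OF this]
  have "recursive 2 (\<lambda>xs. rec_nat (xs ! 0) (\<lambda>n y. y - 1) (xs ! 1))"
    by (intro recursive_rec_nat pred recursive_atoms) auto
  moreover have "rec_nat m (\<lambda>n y. y - 1) n = m - n" for m n :: nat by (induction n) auto
  ultimately show "recursive 2 (\<lambda>xs. xs ! 0 - xs ! 1)" by simp
qed

lemma recursive_sum:
  assumes "recursive k h" "recursive (Suc k) (\<lambda>xs. g (hd xs) (tl xs))"
  shows "recursive k (\<lambda>xs. \<Sum>i<h xs. g i xs)"
proof -
  have "recursive (Suc (Suc k)) (\<lambda>xs. g (hd xs) (tl (tl xs)))"
    using recursive_comp_drop[of "[hd]" k "\<lambda>ys. g (hd ys) (tl ys)" "Suc (Suc 0)"] assms(2)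
    by (auto simp: drop_Suc recursive_atoms)
  then have "recursive k (\<lambda>xs. rec_nat 0 (\<lambda>n y. y + g n xs) (h xs))"
    by (intro recursive_rec_nat recursive_add recursive_atoms assms) auto
  moreover have "rec_nat 0 (\<lambda>n y. y + g n xs) n = (\<Sum>i<n. g i xs)" for n xs
    by (induction n) auto
  ultimately show ?thesis by simp
qed

section \<open>Recursive relations, bounded quantifiers and case distinction\<close>

lemma recursive_of_bool: "recursive_rel k P \<Longrightarrow> recursive k (\<lambda>xs. of_bool (P xs))"
  by (simp add: recursive_rel_def)

lemma recursive_rel_cong:
  assumes "recursive_rel k Q" "\<And>xs. P xs \<longleftrightarrow> Q xs"
  shows "recursive_rel k P"
  using assms(1) ext[of P Q, OF assms(2)] by simp

lemma recursive_rel_not: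
  assumes "recursive_rel k P" shows "recursive_rel k (\<lambda>xs. \<not> P xs)"
proof -
  have "recursive k (\<lambda>xs. 1 - of_bool (P xs))"
    by (intro recursive_diff recursive_of_bool assms recursive_const)
  then show ?thesis unfolding recursive_rel_def by (rule recursive_cong) simp
qed

lemma recursive_rel_conj:
  assumes "recursive_rel k P" "recursive_rel k Q" shows "recursive_rel k (\<lambda>xs. P xs \<and> Q xs)"
proof -
  have "recursive k (\<lambda>xs. of_bool (P xs) * of_bool (Q xs))"
    by (intro recursive_mult recursive_of_bool assms)
  then show ?thesis by (simp add: recursive_rel_def of_bool_conj)
qed

lemma recursive_rel_disj:
  assumes "recursive_rel k P" "recursive_rel k Q" shows "recursive_rel k (\<lambda>xs. P xs \<or> Q xs)"
  using recursive_rel_not[OF recursive_rel_conj[OF assms[THEN recursive_rel_not]]] by simp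

lemma recursive_rel_imp:
  assumes "recursive_rel k P" "recursive_rel k Q" shows "recursive_rel k (\<lambda>xs. P xs \<longrightarrow> Q xs)"
  by (rule recursive_rel_cong[OF recursive_rel_disj[OF recursive_rel_not[OF assms(1)] assms(2)]]) blast

lemma recursive_rel_le:
  assumes "recursive k f" "recursive k g" shows "recursive_rel k (\<lambda>xs. f xs \<le> g xs)"
proof -
  have "recursive k (\<lambda>xs. 1 - (f xs - g xs))"
    by (intro recursive_diff assms recursive_const)
  moreover have "1 - (m - n) = of_bool (m \<le> n)" for m n :: nat by auto
  ultimately show ?thesis by (simp add: recursive_rel_def)
qed

lemma recursive_rel_less:
  assumes "recursive k f" "recursive k g" shows "recursive_rel k (\<lambda>xs. f xs < g xs)"
  using recursive_rel_not[OF recursive_rel_le[OF assms(2,1)]] by (simp add: not_le)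

lemma recursive_rel_eq:
  assumes "recursive k f" "recursive k g" shows "recursive_rel k (\<lambda>xs. f xs = g xs)"
  by (rule recursive_rel_cong[OF recursive_rel_conj[OF recursive_rel_le[OF assms] recursive_rel_le[OF assms(2,1)]]])
    auto

lemma recursive_rel_ball:
  assumes "recursive k h" "recursive_rel (Suc k) (\<lambda>xs. P (hd xs) (tl xs))"
  shows "recursive_rel k (\<lambda>xs. \<forall>i<h xs. P i xs)"
proof -
  \<comment> \<open>The number of counterexamples, a bounded sum, is compared with 0.\<close>
  have "recursive_rel k (\<lambda>xs. (\<Sum>i<h xs. of_bool (\<not> P i xs)) = (0::nat))"
    by (intro recursive_rel_eq recursive_sum recursive_of_bool recursive_rel_not assms recursive_const)
  then show ?thesis by (rule recursive_rel_cong) auto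
qed

lemma recursive_rel_bex:
  assumes "recursive k h" "recursive_rel (Suc k) (\<lambda>xs. P (hd xs) (tl xs))"
  shows "recursive_rel k (\<lambda>xs. \<exists>i<h xs. P i xs)"
  using recursive_rel_not[OF recursive_rel_ball[OF assms(1) recursive_rel_not[OF assms(2)]]] by simp

lemma recursive_rel_odd:
  assumes "recursive k f" shows "recursive_rel k (\<lambda>xs. odd (f xs))"
proof -
  have "recursive k (\<lambda>xs. rec_nat 0 (\<lambda>n y. 1 - y) (f xs))"
    by (intro recursive_rec_nat recursive_diff recursive_atoms assms) auto
  moreover have "rec_nat 0 (\<lambda>n y. 1 - y) n = (of_bool (odd n) :: nat)" for n by (induction n) auto
  ultimately show ?thesis by (simp add: recursive_rel_def)
qed

lemma recursive_if:
  assumes "recursive_rel k P" "recursive k f" "recursive k g"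
  shows "recursive k (\<lambda>xs. if P xs then f xs else g xs)"
proof -
  have "recursive k (\<lambda>xs. of_bool (P xs) * f xs + of_bool (\<not> P xs) * g xs)"
    by (intro recursive_add recursive_mult recursive_of_bool recursive_rel_not assms)
  then show ?thesis by (rule recursive_cong) simp
qed

lemmas recursive_intros = recursive_atoms recursive_add recursive_mult recursive_power
  recursive_diff recursive_sum recursive_of_bool recursive_rel_not recursive_rel_conj
  recursive_rel_disj recursive_rel_imp recursive_rel_le recursive_rel_less recursive_rel_eq
  recursive_rel_ball recursive_rel_bex recursive_rel_odd recursive_if


section \<open>Bounded evaluation\<close>

text \<open>The value is shifted by one, 0 meaning that the fuel did not suffice. The fuel bounds only
  the range of the searches, so evaluation is total and recursive.\<close>

fun run :: "recf \<Rightarrow> nat \<Rightarrow> nat list \<Rightarrow> nat" where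
  "run Zero s xs = 1"
| "run Succ s xs = (if length xs = 1 then Suc (Suc (xs ! 0)) else 0)"
| "run (Proj i) s xs = (if i < length xs then Suc (xs ! i) else 0)"
| "run (Comp f gs) s xs =
    (if \<exists>g\<in>set gs. run g s xs = 0 then 0 else run f s (map (\<lambda>g. run g s xs - 1) gs))"
| "run (PrimRec f g) s xs =
    (if xs = [] then 0
     else rec_nat (run f s (tl xs))
       (\<lambda>m v. if v = 0 then 0 else run g s (m # (v - 1) # tl xs)) (hd xs))"
| "run (Mu f) s xs =
    (\<Sum>m<s. if run f s (m # xs) = 1 \<and> (\<forall>j<m. 1 < run f s (j # xs)) then Suc m else 0)"

text \<open>A zero with only positive values before it is unique, so the sum in the
  \<open>Mu\<close> case has a single nonzero term. Values are shifted: 1 stands for the value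
  0.\<close>

lemma run_Mu_eq:
  assumes "m < s" "run f s (m # xs) = 1" "\<And>j. j < m \<Longrightarrow> 1 < run f s (j # xs)"
  shows "run (Mu f) s xs = Suc m"
proof -
  have "(run f s (n # xs) = 1 \<and> (\<forall>j<n. 1 < run f s (j # xs))) \<longleftrightarrow> n = m" for n
    using assms(2,3) by (cases n m rule: linorder_cases) force+
  then show ?thesis using assms(1) by simp
qed

lemma run_Mu_Suc:
  assumes "run (Mu f) s xs = Suc m"
  shows "m < s" "run f s (m # xs) = 1" "\<And>j. j < m \<Longrightarrow> 1 < run f s (j # xs)"
proof -
  have "\<exists>n<s. run f s (n # xs) = 1 \<and> (\<forall>j<n. 1 < run f s (j # xs))"
  proof (rule ccontr)
    assume "\<not> ?thesis"
    then have "run (Mu f) s xs = 0" by simp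
    with assms show False by simp
  qed
  then obtain n where n: "n < s" "run f s (n # xs) = 1" "\<And>j. j < n \<Longrightarrow> 1 < run f s (j # xs)"
    by blast
  from run_Mu_eq[OF this] assms have "n = m" by simp
  with n show "m < s" "run f s (m # xs) = 1" "\<And>j. j < m \<Longrightarrow> 1 < run f s (j # xs)" by simp_all
qed

lemma run_sound: "run f s xs = Suc y \<Longrightarrow> computes f xs y"
proof (induction f s xs arbitrary: y rule: run.induct)
  case (1 s xs)
  then show ?case by (simp add: computes.zero)
next
  case (2 s xs)
  then show ?case by (cases xs) (auto intro: computes.succ split: if_splits)
next
  case (3 i s xs)
  then show ?case by (auto intro: computes.proj split: if_splits)
next
  case (4 f gs s xs)
  then have halt: "\<And>g. g \<in> set gs \<Longrightarrow> run g s xs \<noteq> 0"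
    and f: "computes f (map (\<lambda>g. run g s xs - 1) gs) y"
    by (auto split: if_splits)
  have "computes g xs (run g s xs - 1)" if "g \<in> set gs" for g
    using "4.IH"(1)[OF that] halt[OF that] by simp
  with f show ?case by (intro computes.comp[where ys = "map (\<lambda>g. run g s xs - 1) gs"]) auto
next
  case (5 f g s xs)
  then obtain n zs where xs: "xs = n # zs" by (cases xs) auto
  have "computes (PrimRec f g) (n # zs) y"
    if "rec_nat (run f s zs) (\<lambda>m v. if v = 0 then 0 else run g s (m # (v - 1) # zs)) n = Suc y" for n y
    using that
  proof (induction n arbitrary: y)
    case 0
    then show ?case using "5.IH"(1) xs by (auto intro: computes.primrec_0)
  next
    case (Suc n)
    define v where "v = rec_nat (run f s zs) (\<lambda>m v. if v = 0 then 0 else run g s (m # (v - 1) # zs)) n"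
    from Suc.prems have "v \<noteq> 0" "run g s (n # (v - 1) # zs) = Suc y"
      by (auto simp: v_def split: if_splits)
    moreover from this have "computes (PrimRec f g) (n # zs) (v - 1)"
      by (intro Suc.IH) (simp add: v_def)
    ultimately show ?case using "5.IH"(2) xs by (auto intro: computes.primrec_Suc)
  qed
  with "5.prems" xs show ?case by (simp cong: if_cong)
next
  case (6 f s xs)
  note run = run_Mu_Suc[OF "6.prems"]
  have "computes f (y # xs) 0"
    using "6.IH" run(1,2) by simp
  moreover have "\<exists>z>0. computes f (m # xs) z" if "m < y" for m
    using "6.IH"[of m "run f s (m # xs) - 1"] run(1) run(3)[OF that] that
    by (intro exI[of _ "run f s (m # xs) - 1"]) simp
  ultimately show ?case by (blast intro: computes.mu)
qed

text \<open>Conditions that hold for all large fuel can be combined over finitely many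
  subcomputations, without a proof that \<open>run\<close> is monotone in the fuel.\<close>

lemma run_complete: "computes f xs y \<Longrightarrow> eventually (\<lambda>s. run f s xs = Suc y) sequentially"
proof (induction rule: computes.induct)
  case (comp ys gs xs f z)
  have "eventually (\<lambda>s. \<forall>i\<in>{..<length gs}. run (gs ! i) s xs = Suc (ys ! i)) sequentially"
    using comp.IH(1) by (intro eventually_ball_finite) auto
  with comp.IH(2) show ?case
  proof eventually_elim
    case (elim s)
    have "map (\<lambda>g. run g s xs - 1) gs = ys"
      by (rule nth_equalityI) (use elim comp.hyps in auto)
    moreover have "run g s xs \<noteq> 0" if "g \<in> set gs" for g
      using that elim by (auto simp: in_set_conv_nth)
    ultimately show ?case using elim by simp
  qed
next
  case (primrec_Suc f g n xs y z)
  from primrec_Suc.IH show ?case by eventually_elim (simp cong: if_cong)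
next
  case (mu f n xs)
  have "\<forall>m\<in>{..<n}. eventually (\<lambda>s. 1 < run f s (m # xs)) sequentially"
  proof
    fix m assume "m \<in> {..<n}"
    then obtain y where "y > 0" "eventually (\<lambda>s. run f s (m # xs) = Suc y) sequentially"
      using mu.IH(2) by auto
    then show "eventually (\<lambda>s. 1 < run f s (m # xs)) sequentially"
      by (auto elim: eventually_mono)
  qed
  then have "eventually (\<lambda>s. \<forall>m\<in>{..<n}. 1 < run f s (m # xs)) sequentially"
    by (intro eventually_ball_finite) auto
  with mu.IH(1) eventually_gt_at_top[of n] show ?case
    by eventually_elim (auto intro!: run_Mu_eq simp del: run.simps)
qed simp_all

lemma computes_iff_run: "(\<exists>y. computes f xs y) \<longleftrightarrow> (\<exists>s. 0 < run f s xs)"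
proof
  assume "\<exists>y. computes f xs y"
  then obtain y where "eventually (\<lambda>s. run f s xs = Suc y) sequentially"
    using run_complete by blast
  then obtain s where "run f s xs = Suc y"
    by (auto simp: eventually_sequentially)
  then show "\<exists>s. 0 < run f s xs" by (intro exI[of _ s]) simp
next
  assume "\<exists>s. 0 < run f s xs"
  then show "\<exists>y. computes f xs y" by (auto simp: gr0_conv_Suc intro: run_sound)
qed

text \<open>The program is fixed, so no coding of programs is needed and induction on
  \<open>f\<close> suffices. The arity is general because subprograms are evaluated at other
  arities.\<close>

lemma recursive_run: "recursive (Suc k) (\<lambda>xs. run f (hd xs) (tl xs))"
proof (induction f arbitrary: k)
  case Zero
  show ?case by (simp add: recursive_const)
next
  case Succ
  have "recursive (Suc k) (\<lambda>xs. if k = 1 then Suc (Suc (tl xs ! 0)) else 0)"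
    by (cases "k = 1") (auto intro!: recursive_intros)
  then show ?case by (rule recursive_cong) auto
next
  case (Proj i)
  have "recursive (Suc k) (\<lambda>xs. if i < k then Suc (tl xs ! i) else 0)"
    by (cases "i < k") (auto intro!: recursive_intros)
  then show ?case by (rule recursive_cong) auto
next
  case (Comp f gs)
  have "recursive (Suc k) (\<lambda>xs. (\<lambda>ys. run f (hd ys) (tl ys))
      (map (\<lambda>G. G xs) (hd # map (\<lambda>g xs. run g (hd xs) (tl xs) - 1) gs)))"
    by (rule recursive_list_comp)
      (use Comp.IH(1)[of "length gs"] Comp.IH(2) in \<open>auto intro!: recursive_hd recursive_diff recursive_const\<close>)
  then have *: "recursive (Suc k) (\<lambda>xs. run f (hd xs) (map (\<lambda>g. run g (hd xs) (tl xs) - 1) gs))"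
    by (simp add: comp_def)
  \<comment> \<open>As \<open>gs\<close> is fixed, the quantifier over it is a finite disjunction,
    built up along the list.\<close>
  have "recursive_rel (Suc k) (\<lambda>xs. \<exists>g\<in>set hs. run g (hd xs) (tl xs) = 0)" if "set hs \<subseteq> set gs" for hs
    using that
  proof (induction hs)
    case Nil
    show ?case by (simp add: recursive_rel_def recursive_const)
  next
    case (Cons h hs)
    then show ?case using Comp.IH(2)[of h]
      by (auto intro!: recursive_rel_disj recursive_rel_eq recursive_const)
  qed
  from recursive_if[OF this[OF order.refl] recursive_const[of _ 0] *] show ?case by simp
next
  case (PrimRec f g)
  show ?case
  proof (cases k)
    case 0
    have "recursive (Suc k) (\<lambda>xs. 0)" by (rule recursive_const)
    then show ?thesis by (rule recursive_cong) (use 0 in \<open>auto simp: length_Suc_conv\<close>)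
  next
    case (Suc k')
    have f: "recursive (Suc k) (\<lambda>xs. run f (hd xs) (tl (tl xs)))"
      using recursive_comp_drop[of "[hd]" k' "\<lambda>ys. run f (hd ys) (tl ys)" "Suc (Suc 0)"]
        PrimRec.IH(1)[of k'] Suc
      by (auto simp: drop_Suc recursive_atoms)
    have pred: "recursive (Suc (Suc (Suc k))) (\<lambda>xs. hd (tl xs) - Suc 0)"
      by (intro recursive_diff recursive_atoms) auto
    \<comment> \<open>The arguments are index, accumulator, fuel, recursion argument and parameters,
      hence four entries to drop.\<close>
    have g: "recursive (Suc (Suc (Suc k)))
        (\<lambda>xs. run g (hd (tl (tl xs))) (hd xs # (hd (tl xs) - 1) # tl (tl (tl (tl xs)))))"
      using recursive_comp_drop[of "[\<lambda>xs. hd (tl (tl xs)), hd, \<lambda>xs. hd (tl xs) - 1]" k'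
          "\<lambda>ys. run g (hd ys) (tl ys)" "Suc (Suc (Suc (Suc 0)))"] PrimRec.IH(2)[of "Suc (Suc k')"] Suc pred
      by (auto simp: drop_Suc recursive_atoms)
    have "recursive (Suc k) (\<lambda>xs. rec_nat (run f (hd xs) (tl (tl xs)))
       (\<lambda>m v. if v = 0 then 0 else run g (hd xs) (m # (v - 1) # tl (tl xs))) (hd (tl xs)))"
      by (intro recursive_rec_nat recursive_if recursive_rel_eq f g recursive_atoms)
        (auto simp: Suc)
    then show ?thesis by (rule recursive_cong) (use Suc in \<open>auto simp: length_Suc_conv\<close>)
  qed
next
  case (Mu f)
  have f: "recursive (Suc (Suc k)) (\<lambda>xs. run f (hd (tl xs)) (hd xs # tl (tl xs)))"
    using recursive_comp_drop[of "[\<lambda>xs. hd (tl xs), hd]" k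
        "\<lambda>ys. run f (hd ys) (tl ys)" "Suc (Suc 0)"] Mu.IH[of "Suc k"]
    by (auto simp: drop_Suc recursive_atoms)
  have f': "recursive (Suc (Suc (Suc k))) (\<lambda>xs. run f (hd (tl (tl xs))) (hd xs # tl (tl (tl xs))))"
    using recursive_comp_drop[of "[\<lambda>xs. hd (tl (tl xs)), hd]" k
        "\<lambda>ys. run f (hd ys) (tl ys)" "Suc (Suc (Suc 0))"] Mu.IH[of "Suc k"]
    by (auto simp: drop_Suc recursive_atoms)
  show ?case unfolding run.simps
    by (intro recursive_sum recursive_if recursive_rel_conj recursive_rel_eq recursive_rel_ball
      recursive_rel_less f f' recursive_atoms) auto
qed


section \<open>Approximation of numberings from below\<close>

text \<open>Removes the logarithm: \<open>len x\<close> counts the powers of 2 up to x, and such a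
  count is a bounded sum.\<close>

lemma less_len_iff: "l < len x \<longleftrightarrow> 2 ^ l \<le> x"
proof -
  have "l < len x \<longleftrightarrow> real l < log 2 (real x + 1)"
    by (simp add: len_def zless_nat_eq_int_zless less_ceiling_iff)
  also have "\<dots> \<longleftrightarrow> 2 ^ l < real x + 1"
    by (subst less_log_iff) (auto simp: powr_realpow)
  also have "\<dots> \<longleftrightarrow> real (2 ^ l) < real (x + 1)"
    by (simp add: add.commute)
  also have "\<dots> \<longleftrightarrow> 2 ^ l < x + 1"
    by (rule of_nat_less_iff)
  finally show ?thesis by auto
qed

lemma len_le: "len x \<le> x"
  using less_len_iff[of x x] less_exp[of x] by linarith

lemma recursive_len:
  assumes "recursive k f" shows "recursive k (\<lambda>xs. len (f xs))"
proof -
  have "(\<Sum>l<x. of_bool (2 ^ l \<le> x)) = len x" for x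
  proof -
    have "{..<x} \<inter> {l. 2 ^ l \<le> x} = {..<len x}"
      using len_le[of x] by (auto simp flip: less_len_iff)
    then show ?thesis by simp
  qed
  moreover have "recursive 1 (\<lambda>xs. \<Sum>l<xs ! 0. of_bool (2 ^ l \<le> xs ! 0))"
    by (intro recursive_intros) auto
  ultimately show ?thesis using recursive_comp1[of len, OF _ assms] by simp
qed

lemma left_re_numbering_computes:
  assumes "left_re_numbering \<beta>"
  obtains f where "\<And>e. ((\<lambda>x. 1 / 2 ^ len x) has_sum \<beta> e) {x. \<exists>y. computes f [e, x] y}"
proof -
  obtain \<phi> f where f: "\<And>xs y. length xs = 2 \<Longrightarrow> \<phi> (xs ! 0) (xs ! 1) = Some y \<longleftrightarrow> computes f xs y"
    and sum: "\<And>e. ((\<lambda>x. 1 / 2 ^ len x) has_sum \<beta> e) (dom (\<phi> e))"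
    using assms unfolding left_re_numbering_def partial_recursive_def by blast
  have "dom (\<phi> e) = {x. \<exists>y. computes f [e, x] y}" for e
    using f[of "[e, _]"] by auto
  with sum show ?thesis by (intro that[of f]) simp
qed

lemma recursive_run2:
  assumes "recursive k t" "recursive k g" "recursive k h"
  shows "recursive k (\<lambda>xs. run f (t xs) [g xs, h xs])"
  using recursive_list_comp[of "[t, g, h]" "\<lambda>xs. run f (hd xs) (tl xs)" k] recursive_run[of 2 f] assms
  by (simp add: eval_nat_numeral)

text \<open>With the denominator fixed as \<open>2 ^ s\<close>, only numerators are computed and
  comparisons become inequalities between naturals.\<close>

definition left_approx :: "(nat \<Rightarrow> nat \<Rightarrow> nat) \<Rightarrow> (nat \<Rightarrow> real) \<Rightarrow> bool" where
  "left_approx N \<beta> \<longleftrightarrow> recursive 2 (\<lambda>xs. N (xs ! 0) (xs ! 1)) \<and>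
    (\<forall>e. mono (\<lambda>s. real (N e s) / 2 ^ s)) \<and> (\<forall>e. (\<lambda>s. real (N e s) / 2 ^ s) \<longlonglongrightarrow> \<beta> e)"

lemma left_approx_le: "left_approx N \<beta> \<Longrightarrow> real (N e s) / 2 ^ s \<le> \<beta> e"
  unfolding left_approx_def by (intro incseq_le[of "\<lambda>s. real (N e s) / 2 ^ s"]) auto

lemma left_approx_mono:
  "left_approx N \<beta> \<Longrightarrow> s \<le> t \<Longrightarrow> real (N e s) / 2 ^ s \<le> real (N e t) / 2 ^ t"
  unfolding left_approx_def by (intro monoD[of "\<lambda>s. real (N e s) / 2 ^ s"]) auto

lemma left_re_numbering_approx:
  assumes "left_re_numbering \<beta>"
  obtains N where "left_approx N \<beta>"
proof -
  obtain f where f: "\<And>e. ((\<lambda>x. 1 / 2 ^ len x) has_sum \<beta> e) {x. \<exists>y. computes f [e, x] y}"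
    using left_re_numbering_computes[OF assms] by blast
  \<comment> \<open>Admitting all fuels below s makes \<open>D e s\<close> increase with s by
    construction.\<close>
  define D where "D e s = {x. x < s \<and> (\<exists>t<s. 0 < run f t [e, x])}" for e s
  \<comment> \<open>For x < s, \<open>len x\<close> is at most s, so the exponent is not
    truncated.\<close>
  define N :: "nat \<Rightarrow> nat \<Rightarrow> nat" where "N e s = (\<Sum>x<s. of_bool (\<exists>t<s. 0 < run f t [e, x]) * 2 ^ (s - len x))" for e s
  have N_eq: "real (N e s) / 2 ^ s = (\<Sum>x\<in>D e s. 1 / 2 ^ len x)" for e s
  proof -
    have D: "D e s = {x \<in> {..<s}. \<exists>t<s. 0 < run f t [e, x]}" by (auto simp: D_def)
    have "N e s = (\<Sum>x<s. if \<exists>t<s. 0 < run f t [e, x] then 2 ^ (s - len x) else 0)"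
      unfolding N_def by (rule sum.cong) auto
    also have "\<dots> = (\<Sum>x\<in>D e s. 2 ^ (s - len x))"
      unfolding D by (rule sum.inter_filter[symmetric]) simp
    finally have "real (N e s) / 2 ^ s = (\<Sum>x\<in>D e s. 2 ^ (s - len x) / 2 ^ s)"
      by (simp add: sum_divide_distrib)
    also have "\<dots> = (\<Sum>x\<in>D e s. 1 / 2 ^ len x)"
    proof (rule sum.cong)
      fix x assume "x \<in> D e s"
      then have "len x \<le> s" using len_le[of x] by (simp add: D_def)
      then show "(2::real) ^ (s - len x) / 2 ^ s = 1 / 2 ^ len x"
        by (simp add: power_diff)
    qed simp
    finally show ?thesis .
  qed
  have mono: "mono (\<lambda>s. real (N e s) / 2 ^ s)" for e
    unfolding N_eq by (intro monoI sum_mono2) (auto simp: D_def, meson less_le_trans)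
  have lim: "(\<lambda>s. real (N e s) / 2 ^ s) \<longlonglongrightarrow> \<beta> e" for e
  proof -
    \<comment> \<open>The sum over the domain is a limit along its finite subsets, and each of these
      is eventually contained in \<open>D e s\<close>.\<close>
    have "filterlim (D e) (finite_subsets_at_top {x. \<exists>y. computes f [e, x] y}) sequentially"
      unfolding filterlim_finite_subsets_at_top
    proof (intro allI impI)
      fix X assume X: "finite X \<and> X \<subseteq> {x. \<exists>y. computes f [e, x] y}"
      have "\<forall>x\<in>X. eventually (\<lambda>s. x \<in> D e s) sequentially"
      proof
        fix x assume "x \<in> X"
        with X obtain t where "0 < run f t [e, x]" using computes_iff_run by blast
        then have "x \<in> D e s" if "Suc (x + t) \<le> s" for s
          using that by (auto simp: D_def intro!: exI[of _ t])
        then show "eventually (\<lambda>s. x \<in> D e s) sequentially"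
          unfolding eventually_sequentially by blast
      qed
      then have "eventually (\<lambda>s. \<forall>x\<in>X. x \<in> D e s) sequentially"
        using X by (intro eventually_ball_finite) auto
      then show "eventually (\<lambda>s. finite (D e s) \<and> X \<subseteq> D e s \<and>
          D e s \<subseteq> {x. \<exists>y. computes f [e, x] y}) sequentially"
        by eventually_elim (auto simp: D_def computes_iff_run)
    qed
    with f[of e] show ?thesis
      unfolding N_eq has_sum_def by (rule filterlim_compose)
  qed
  have "recursive 2 (\<lambda>xs. N (xs ! 0) (xs ! 1))"
    unfolding N_def by (intro recursive_run2 recursive_len recursive_intros) auto
  with mono lim that show ?thesis by (auto simp: left_approx_def)
qed


section \<open>Coding sets into left-r.e. reals\<close>

text \<open>The ceiling is constant between \<open>\<lceil>l\<rceil> - 1\<close> (excluded) and l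
  (included), where an approximation from below must end up.\<close>

lemma ceiling_eventually_eq:
  fixes y :: "nat \<Rightarrow> real"
  assumes "y \<longlonglongrightarrow> l" "\<And>s. y s \<le> l"
  shows "eventually (\<lambda>s. \<lceil>y s\<rceil> = \<lceil>l\<rceil>) sequentially"
proof -
  have "of_int \<lceil>l\<rceil> - 1 < l" by linarith
  from order_tendstoD(1)[OF assms(1) this] show ?thesis
  proof eventually_elim
    case (elim s)
    with assms(2)[of s] show ?case unfolding ceiling_eq_iff by linarith
  qed
qed

definition ceiling_div :: "nat \<Rightarrow> nat \<Rightarrow> nat" where
  "ceiling_div x y = (\<Sum>j<x. of_bool (j * y < x))"

lemma ceiling_div_eq:
  assumes "0 < y" shows "int (ceiling_div x y) = \<lceil>real x / real y\<rceil>"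
proof -
  have "j < nat \<lceil>real x / real y\<rceil> \<longleftrightarrow> j * y < x" for j
  proof -
    have "j < nat \<lceil>real x / real y\<rceil> \<longleftrightarrow> real j < real x / real y"
      by (simp add: zless_nat_eq_int_zless less_ceiling_iff)
    also have "\<dots> \<longleftrightarrow> real (j * y) < real x"
      using assms by (simp add: less_divide_eq)
    finally show ?thesis by (simp only: of_nat_less_iff)
  qed
  moreover have "j < x" if "j * y < x" for j
    using that assms by (cases y) auto
  ultimately have "{..<x} \<inter> {j. j * y < x} = {..<nat \<lceil>real x / real y\<rceil>}"
    by auto
  moreover have "0 \<le> \<lceil>real x / real y\<rceil>"
    by (rule order.trans[of _ "\<lceil>0::real\<rceil>"]) (simp, intro ceiling_mono, simp)
  ultimately show ?thesis by (simp add: ceiling_div_def del: zero_le_ceiling)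
qed

lemma recursive_ceiling_div:
  assumes "recursive k f" "recursive k g"
  shows "recursive k (\<lambda>xs. ceiling_div (f xs) (g xs))"
proof (rule recursive_comp2[OF _ assms])
  show "recursive 2 (\<lambda>xs. ceiling_div (xs ! 0) (xs ! 1))"
    unfolding ceiling_div_def by (intro recursive_intros) auto
qed

section \<open>Decoding numbers by distances to squares\<close>

definition sqrt_floor :: "nat \<Rightarrow> nat" where
  "sqrt_floor k = (\<Sum>j<k. of_bool (Suc j * Suc j \<le> k))"

text \<open>The distance to the largest square not above k takes the place of an inverse pairing
  function.\<close>

definition sqrt_rest :: "nat \<Rightarrow> nat" where
  "sqrt_rest k = k - sqrt_floor k * sqrt_floor k"

lemma sqrt_floor_eq:
  assumes "n \<le> 2 * m" shows "sqrt_floor (m * m + n) = m"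
proof -
  have "Suc j * Suc j \<le> m * m + n \<longleftrightarrow> j < m" for j
  proof
    assume "Suc j * Suc j \<le> m * m + n"
    also have "\<dots> < Suc m * Suc m" using assms by simp
    finally show "j < m" by (metis Suc_less_eq mult_le_mono not_less)
  next
    assume "j < m"
    then have "Suc j * Suc j \<le> m * m" by (intro mult_le_mono) auto
    then show "Suc j * Suc j \<le> m * m + n" by simp
  qed
  moreover have "j < m * m + n" if "j < m" for j
    using that by (cases m) auto
  ultimately have "{..<m * m + n} \<inter> {j. Suc j * Suc j \<le> m * m + n} = {..<m}"
    by auto
  then show ?thesis by (simp add: sqrt_floor_def del: mult_Suc mult_Suc_right)
qed

lemma sqrt_rest_eq: "n \<le> 2 * m \<Longrightarrow> sqrt_rest (m * m + n) = n"
  by (simp add: sqrt_rest_def sqrt_floor_eq)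

lemma sqrt_rest_surj: "\<exists>k\<ge>b. sqrt_rest k = n \<and> sqrt_rest (sqrt_floor k) = e"
proof -
  \<comment> \<open>With \<open>k = m * m + n\<close> and \<open>m = j * j + e\<close> the two
    remainders are n and e, provided that these are at most \<open>2 * m\<close> and
    \<open>2 * j\<close>. The size of j ensures this, and also that k is at least b.\<close>
  define j where "j = b + n + e"
  define m where "m = j * j + e"
  have j: "j \<le> m" "m \<le> m * m" by (simp_all add: m_def trans_le_add1)
  then have "b \<le> m * m + n" "n \<le> 2 * m" unfolding j_def by linarith+
  moreover have "sqrt_rest m = e" unfolding m_def by (rule sqrt_rest_eq) (simp add: j_def)
  ultimately show ?thesis
    using sqrt_rest_eq[of n m] sqrt_floor_eq[of n m] by (intro exI[of _ "m * m + n"]) simp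
qed

lemma recursive_sqrt_floor: "recursive k f \<Longrightarrow> recursive k (\<lambda>xs. sqrt_floor (f xs))"
proof (erule recursive_comp1[rotated])
  show "recursive 1 (\<lambda>xs. sqrt_floor (xs ! 0))"
    unfolding sqrt_floor_def by (intro recursive_intros) auto
qed

lemma recursive_sqrt_rest: "recursive k f \<Longrightarrow> recursive k (\<lambda>xs. sqrt_rest (f xs))"
  unfolding sqrt_rest_def by (intro recursive_intros recursive_sqrt_floor)

lemma sum_two_over_four_powers:
  "m \<le> s \<Longrightarrow> (\<Sum>i=m..<s. 2 / 4 ^ Suc i) = (2/3) * (1 / 4 ^ m - 1 / 4 ^ s :: real)"
proof (induction s rule: dec_induct)
  case (step s)
  then have "(\<Sum>i=m..<Suc s. 2 / 4 ^ Suc i) = (2/3) * (1 / 4 ^ m - 1 / 4 ^ s) + (2 / 4 ^ Suc s :: real)"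
    by simp
  also have "\<dots> = (2/3) * (1 / 4 ^ m - 1 / 4 ^ Suc s)"
    by (simp add: field_simps)
  finally show ?case .
qed simp

text \<open>The real is written in base 4 with digits 1 and 2 only, so that it is never dyadic and its
  digits can be read off from ceilings, which are continuous from the left.\<close>

lemma left_re_coding:
  assumes rec: "recursive_rel 2 (\<lambda>xs. B (xs ! 0) (xs ! 1))"
    and mono_B: "\<And>k s t. B k s \<Longrightarrow> s \<le> t \<Longrightarrow> B k t"
  obtains r where "left_re r" "\<And>k. odd \<lceil>4 ^ Suc k * r\<rceil> \<longleftrightarrow> (\<exists>s. B k s)"
proof -
  \<comment> \<open>A digit only ever changes from 1 to 2, so the approximations increase.\<close>
  define d :: "nat \<Rightarrow> nat \<Rightarrow> nat" where "d i s = 1 + of_bool (B i s)" for i s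
  define a where "a s = (\<Sum>i<s. d i s * 4 ^ (s - Suc i))" for s
  define x :: "nat \<Rightarrow> real" where "x s = (\<Sum>i<s. d i s / 4 ^ Suc i)" for s
  \<comment> \<open>The shape demanded by \<open>recursive_rat_seq\<close>; the denominator is
    \<open>4 ^ s\<close>.\<close>
  define q :: "nat \<Rightarrow> rat" where "q s = (of_nat (a s) - of_nat 0) / of_nat (Suc (4 ^ s - 1))" for s
  have d: "1 \<le> d i s" "d i s \<le> 2" for i s by (auto simp: d_def)
  have q_x: "real_of_rat (q s) = x s" for s
  proof -
    have "real_of_rat (q s) = real (a s) / 4 ^ s"
      by (simp add: q_def of_rat_divide of_rat_power del: of_nat_Suc)
    also have "\<dots> = (\<Sum>i<s. real (d i s) * (4 ^ (s - Suc i) / 4 ^ s))"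
      by (simp add: a_def sum_divide_distrib)
    also have "\<dots> = x s"
      unfolding x_def by (intro sum.cong refl) (simp add: power_diff del: power_Suc)
    finally show ?thesis .
  qed
  have mono_x: "mono x"
  proof (rule monoI)
    fix s t :: nat assume "s \<le> t"
    have "x s \<le> (\<Sum>i<s. d i t / 4 ^ Suc i)"
      unfolding x_def using mono_B[OF _ \<open>s \<le> t\<close>]
      by (intro sum_mono divide_right_mono) (auto simp: d_def)
    also have "\<dots> \<le> x t"
      unfolding x_def using \<open>s \<le> t\<close> by (intro sum_mono2) auto
    finally show "x s \<le> x t" .
  qed
  have tail: "(\<Sum>i=m..<s. d i s / 4 ^ Suc i) \<le> (2/3) / (4 ^ m :: real)" if "m \<le> s" for m s
  proof -
    have "(\<Sum>i=m..<s. real (d i s) / 4 ^ Suc i) \<le> (\<Sum>i=m..<s. 2 / 4 ^ Suc i)"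
      using d by (intro sum_mono divide_right_mono) auto
    also have "\<dots> \<le> (2/3) / 4 ^ m"
      using that by (simp add: sum_two_over_four_powers del: power_Suc)
    finally show ?thesis .
  qed
  have x_le: "x s \<le> 2/3" for s
    using tail[of 0 s] by (simp add: x_def atLeast0LessThan)
  then obtain r where lim: "x \<longlonglongrightarrow> r" and le_r: "\<And>s. x s \<le> r"
    using incseq_convergent[OF mono_x] by metis
  have "left_re r"
    unfolding left_re_def
  proof (intro conjI exI[of _ q])
    have "0 \<le> r" using le_r[of 0] by (simp add: x_def)
    moreover have "r \<le> 2/3" using lim x_le by (intro LIMSEQ_le_const2) auto
    ultimately show "r \<in> {0..1}" by simp
    show "mono q" using mono_x unfolding mono_def by (simp flip: q_x add: of_rat_less_eq)
    show "(\<lambda>n. real_of_rat (q n)) \<longlonglongrightarrow> r" using lim by (simp add: q_x)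
    have rec': "recursive_rel k (\<lambda>xs. B (f xs) (g xs))" if "recursive k f" "recursive k g" for k f g
      using recursive_comp2[where f = "\<lambda>x y. of_bool (B x y)", OF _ that] rec by (simp add: recursive_rel_def)
    show "recursive_rat_seq q"
      unfolding recursive_rat_seq_def
    proof (rule exI[of _ a], rule exI[of _ "\<lambda>_. 0"], rule exI[of _ "\<lambda>s. 4 ^ s - 1"], intro conjI allI)
      show "recursive 1 (\<lambda>xs. a (xs ! 0))"
        unfolding a_def d_def by (intro recursive_intros rec') auto
      show "recursive 1 (\<lambda>xs. 4 ^ (xs ! 0) - 1)"
        by (intro recursive_intros) auto
    qed (simp_all add: recursive_const q_def)
  qed
  moreover have "odd \<lceil>4 ^ Suc k * r\<rceil> \<longleftrightarrow> (\<exists>s. B k s)" for k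
  proof -
    \<comment> \<open>M will be the integer part of \<open>4 ^ Suc k * r\<close>: the final digits 0
      to k in base 4.\<close>
    define M where "M = (\<Sum>i<Suc k. (1 + of_bool (\<exists>s. B i s)) * 4 ^ (k - i) :: nat)"
    have ev_d: "eventually (\<lambda>s. \<forall>i\<in>{..<Suc k}. d i s = 1 + of_bool (\<exists>s. B i s)) sequentially"
    proof (intro eventually_ball_finite ballI)
      fix i
      show "eventually (\<lambda>s. d i s = 1 + of_bool (\<exists>s. B i s)) sequentially"
      proof (cases "\<exists>s. B i s")
        case True
        then obtain s where "B i s" by blast
        then have "eventually (\<lambda>t. B i t) sequentially"
          using mono_B unfolding eventually_sequentially by blast
        then show ?thesis by eventually_elim (auto simp: d_def)
      qed (auto simp: d_def)
    qed simp
    \<comment> \<open>The later digits contribute at least 1/4, as the next one is at least 1, and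
      at most 2/3, as all are at most 2. So the ceiling will be M + 1.\<close>
    have bounds: "eventually (\<lambda>s. M + 1/4 \<le> 4 ^ Suc k * x s \<and> 4 ^ Suc k * x s \<le> M + 2/3) sequentially"
      using ev_d eventually_gt_at_top[of "Suc k"]
    proof eventually_elim
      case (elim s)
      define T where "T = (\<Sum>i=Suc k..<s. real (d i s) / 4 ^ Suc i)"
      have "x s = (\<Sum>i<Suc k. d i s / 4 ^ Suc i) + T"
        unfolding x_def T_def lessThan_atLeast0 using elim
        by (intro sum.atLeastLessThan_concat[symmetric]) auto
      moreover have "4 ^ Suc k * (\<Sum>i<Suc k. d i s / 4 ^ Suc i) = real M"
        unfolding M_def sum_distrib_left of_nat_sum
      proof (rule sum.cong[OF refl])
        fix i assume i: "i \<in> {..<Suc k}"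
        then have "(4::real) ^ Suc k = 4 ^ (k - i) * 4 ^ Suc i"
          by (simp flip: power_add)
        with i elim show "4 ^ Suc k * (real (d i s) / 4 ^ Suc i)
            = real ((1 + of_bool (\<exists>s. B i s)) * 4 ^ (k - i))"
          by simp
      qed
      moreover have "1 / 4 \<le> 4 ^ Suc k * T"
      proof -
        have "1 / 4 ^ Suc (Suc k) \<le> real (d (Suc k) s) / 4 ^ Suc (Suc k)"
          using d(1)[of "Suc k" s] by (intro divide_right_mono) auto
        also have "\<dots> \<le> T"
          unfolding T_def using elim by (intro member_le_sum[where f = "\<lambda>i. real (d i s) / 4 ^ Suc i"]) auto
        finally show ?thesis by (simp add: field_simps)
      qed
      moreover have "4 ^ Suc k * T \<le> 2/3"
      proof -
        have "T \<le> (2/3) / 4 ^ Suc k" unfolding T_def using elim by (intro tail) simp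
        then show ?thesis by (simp add: field_simps)
      qed
      ultimately show ?case by (simp add: distrib_left)
    qed
    have lim': "(\<lambda>s. 4 ^ Suc k * x s) \<longlonglongrightarrow> 4 ^ Suc k * r"
      by (intro tendsto_intros lim)
    have "M + 1/4 \<le> 4 ^ Suc k * r"
      by (rule tendsto_lowerbound[OF lim' eventually_mono[OF bounds]]) auto
    moreover have "4 ^ Suc k * r \<le> M + 2/3"
      by (rule tendsto_upperbound[OF lim' eventually_mono[OF bounds]]) auto
    ultimately have "\<lceil>4 ^ Suc k * r\<rceil> = int M + 1"
      unfolding ceiling_eq_iff by simp
    \<comment> \<open>All digits before the last carry a factor 4, so M is even iff digit k is
      2.\<close>
    moreover have "even (\<Sum>i<k. (1 + of_bool (\<exists>s. B i s)) * 4 ^ (k - i) :: nat)"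
      by (intro dvd_sum) auto
    then have "even M \<longleftrightarrow> (\<exists>s. B k s)"
      unfolding M_def by (auto simp: of_bool_def)
    ultimately show ?thesis by simp
  qed
  ultimately show ?thesis using that by blast
qed


section \<open>The reals \<open>2 ^ -n / 3\<close>\<close>

definition third :: "nat \<Rightarrow> real" where
  "third n = 1 / (3 * 2 ^ n)"

lemma third_pos: "0 < third n"
  by (simp add: third_def)

lemma third_le: "third n \<le> 1/3"
  by (simp add: third_def field_simps)

lemma third_less_iff: "third m < third n \<longleftrightarrow> n < m"
  by (simp add: third_def field_simps)

lemma third_le_iff: "third m \<le> third n \<longleftrightarrow> n \<le> m"
  by (simp add: third_def field_simps)

text \<open>Clearing denominators leaves a comparison of naturals, to which the closure rules
  apply.\<close>

lemma approx_le_third_iff: "real a / 2 ^ s \<le> third n \<longleftrightarrow> 3 * 2 ^ n * a \<le> 2 ^ s"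
proof -
  have "real a / 2 ^ s \<le> third n \<longleftrightarrow> real (3 * 2 ^ n * a) \<le> real (2 ^ s)"
    by (simp add: third_def field_simps)
  then show ?thesis by (simp only: of_nat_le_iff)
qed

lemma third_less_approx_iff:
  "third n < real a / 2 ^ c + 1 / 2 ^ b \<longleftrightarrow> 2 ^ c * 2 ^ b < 3 * 2 ^ n * (a * 2 ^ b + 2 ^ c)"
proof -
  have "third n < real a / 2 ^ c + 1 / 2 ^ b \<longleftrightarrow>
      real (2 ^ c * 2 ^ b) < real (3 * 2 ^ n * (a * 2 ^ b + 2 ^ c))"
    by (simp add: third_def field_simps)
  then show ?thesis by (simp only: of_nat_less_iff)
qed

section \<open>Binary expansions and left-r.e. approximations of these reals\<close>

lemma binary_value_SCons: "binary_value (b ## X) = (of_bool b + binary_value X) / 2"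
proof -
  have sum: "summable (\<lambda>n. of_bool (Y !! n) / 2 ^ Suc n :: real)" for Y :: "bool stream"
  proof (rule summable_comparison_test')
    show "summable (\<lambda>n. (1/2) ^ Suc n :: real)"
      by (simp add: summable_mult summable_geometric)
    show "norm (of_bool (Y !! n) / 2 ^ Suc n :: real) \<le> (1/2) ^ Suc n" for n
      by (simp add: power_divide)
  qed
  have "binary_value (b ## X) = (\<Sum>n. of_bool (X !! n) / 2 ^ Suc (Suc n)) + of_bool b / 2"
    unfolding binary_value_def using suminf_split_head[OF sum[of "b ## X"]] by simp
  also have "(\<Sum>n. of_bool (X !! n) / 2 ^ Suc (Suc n)) = binary_value X / 2"
    unfolding binary_value_def by (subst suminf_divide[OF sum, symmetric]) (simp add: mult.commute)
  finally show ?thesis by (simp add: add_divide_distrib)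
qed

text \<open>The expansion is n zeros followed by 010101..., and the value y of the periodic part
  satisfies \<open>y = (1 + y) / 4\<close>.\<close>

lemma infinite_real_third: "infinite_real (third n)"
proof -
  define Y where "Y = cycle [False, True]"
  define X where "X = replicate n False @- Y"
  have Y: "Y = False ## True ## Y"
    unfolding Y_def by (subst cycle_decomp) auto
  have bits: "\<not> Y !! (2 * m) \<and> Y !! Suc (2 * m)" for m
  proof (induction m)
    case 0
    show ?case by (subst (1 2) Y) simp
  next
    case (Suc m)
    then show ?case by (subst (1 2) Y) simp
  qed
  have "binary_value Y = (1 + binary_value Y) / 4"
    by (subst Y) (simp add: binary_value_SCons)
  then have "binary_value Y = 1/3" by simp
  then have "binary_value (replicate n False @- Y) = third n"
    by (induction n) (simp_all add: third_def binary_value_SCons)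
  moreover have "infinite {i. \<not> X !! i}"
  proof (rule infinite_super)
    show "range (\<lambda>m. n + 2 * m) \<subseteq> {i. \<not> X !! i}"
      using bits by (auto simp: X_def shift_snth_ge)
    show "infinite (range (\<lambda>m. n + 2 * m))"
      by (rule range_inj_infinite) (auto simp: inj_def)
  qed
  moreover have "infinite {i. X !! i}"
  proof (rule infinite_super)
    show "range (\<lambda>m. n + Suc (2 * m)) \<subseteq> {i. X !! i}"
      using bits by (auto simp: X_def shift_snth_ge simp del: snth.simps)
    show "infinite (range (\<lambda>m. n + Suc (2 * m)))"
      by (rule range_inj_infinite) (auto simp: inj_def)
  qed
  ultimately show ?thesis unfolding infinite_real_def X_def by blast
qed

lemma left_re_third: "left_re (third n)"
  unfolding left_re_def
proof (intro conjI exI)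
  let ?q = "\<lambda>_. 1 / of_nat (3 * 2 ^ n) :: rat"
  show "third n \<in> {0..1}" using third_pos[of n] third_le[of n] by simp
  show "recursive_rat_seq ?q"
    unfolding recursive_rat_seq_def
    by (rule exI[of _ "\<lambda>_. 1"], rule exI[of _ "\<lambda>_. 0"], rule exI[of _ "\<lambda>_. 3 * 2 ^ n - 1"])
      (simp add: recursive_const del: of_nat_Suc of_nat_mult)
  show "mono ?q" by (simp add: mono_def)
  show "(\<lambda>k. real_of_rat (?q k)) \<longlonglongrightarrow> third n"
    by (simp add: third_def of_rat_divide of_rat_mult of_rat_power)
qed

section \<open>Diagonalisation\<close>

text \<open>For a numbering \<open>\<beta>\<close> of a class \<open>third ` A\<close> this is \<open>A\<close>, and as \<open>third\<close> is decreasing, it is \<open>\<Sigma>\<^sub>2\<close>: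
  both inequalities concern reals approximated from below.\<close>

definition hits :: "(nat \<Rightarrow> real) \<Rightarrow> nat set" where
  "hits \<beta> = {n. \<exists>e. third (Suc n) < \<beta> e \<and> \<beta> e \<le> third n}"

text \<open>\<open>Mu (Comp Succ [Zero])\<close> searches for a zero of the constant 1 and never
  halts, so all domains are empty. This numbering serves to show that the final class is
  nonempty.\<close>

lemma left_re_numbering_zero: "left_re_numbering (\<lambda>_. 0)"
proof -
  have "\<not> computes (Mu (Comp Succ [Zero])) xs y" for xs y
  proof
    assume "computes (Mu (Comp Succ [Zero])) xs y"
    then have "computes (Comp Succ [Zero]) (y # xs) 0" by cases
    then show False by cases (auto elim: computes.cases)
  qed
  then have "partial_recursive 2 (\<lambda>xs. None)"
    unfolding partial_recursive_def by (intro exI[of _ "Mu (Comp Succ [Zero])"]) simp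
  then show ?thesis
    unfolding left_re_numbering_def by (intro exI[of _ "\<lambda>_ _. None"]) simp
qed

instance recf :: countable
  by countable_datatype

text \<open>Sums are unique, so a program determines its numbering, and there are countably many
  programs.\<close>

lemma countable_left_re_numberings: "countable {\<beta>. left_re_numbering \<beta>}"
proof (rule countable_subset)
  show "{\<beta>. left_re_numbering \<beta>} \<subseteq> range (\<lambda>f e. \<Sum>\<^sub>\<infinity>x\<in>{x. \<exists>y. computes f [e, x] y}. 1 / 2 ^ len x)"
  proof
    fix \<beta> assume "\<beta> \<in> {\<beta>. left_re_numbering \<beta>}"
    then obtain f where "\<And>e. ((\<lambda>x. 1 / 2 ^ len x) has_sum \<beta> e) {x. \<exists>y. computes f [e, x] y}"
      using left_re_numbering_computes by blast
    then have "\<beta> = (\<lambda>e. \<Sum>\<^sub>\<infinity>x\<in>{x. \<exists>y. computes f [e, x] y}. 1 / 2 ^ len x)"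
      by (intro ext infsumI[symmetric])
    then show "\<beta> \<in> range (\<lambda>f e. \<Sum>\<^sub>\<infinity>x\<in>{x. \<exists>y. computes f [e, x] y}. 1 / 2 ^ len x)" by blast
  qed
qed simp

text \<open>Countably many numberings give countably many sets \<open>hits \<beta>\<close>, too few
  for all sets of naturals.\<close>

lemma ex_not_hits: "\<exists>A. \<forall>\<beta>. left_re_numbering \<beta> \<longrightarrow> A \<noteq> hits \<beta>"
proof (rule ccontr)
  assume "\<not> ?thesis"
  then have "hits ` {\<beta>. left_re_numbering \<beta>} = UNIV" by blast
  then have "countable (UNIV :: nat set set)"
    using countable_image[OF countable_left_re_numberings] by metis
  then have "range (from_nat_into (UNIV :: nat set set)) = Pow UNIV"
    by (simp add: range_from_nat_into)
  then show False using Cantors_theorem by blast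
qed

text \<open>The parity of the ceiling is how \<open>left_re_coding\<close> reads a coded bit. The
  bits at k with \<open>sqrt_rest k = n\<close> are those about n, so one real holds conditions on
  all n; only the bits about n are read from the real with index n.\<close>

definition diagonal :: "(nat \<Rightarrow> real) \<Rightarrow> nat set" where
  "diagonal \<alpha> = {n. \<forall>k. sqrt_rest k = n \<longrightarrow> odd \<lceil>4 ^ Suc k * \<alpha> n\<rceil>}"

lemma diagonal_not_hits:
  assumes "universal_left_re_numbering \<alpha>" "left_re_numbering \<beta>"
  shows "diagonal \<alpha> \<noteq> hits \<beta>"
proof -
  obtain N where N: "left_approx N \<beta>" using left_re_numbering_approx[OF assms(2)] .
  note N_rec = recursive_comp2[where f = N, OF conjunct1[OF N[unfolded left_approx_def]]]
  have N_lim: "\<And>e. (\<lambda>s. real (N e s) / 2 ^ s) \<longlonglongrightarrow> \<beta> e" using N by (simp add: left_approx_def)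
  define row where "row k = sqrt_rest (sqrt_floor k)" for k
  \<comment> \<open>\<open>B k s\<close> refutes that k witnesses
    \<open>sqrt_rest k \<in> hits \<beta>\<close> with index \<open>row k\<close>: either the
    approximation at stage k has not exceeded the lower bound, or that at stage s exceeds the upper
    one. Using k itself as a stage keeps the first part decidable.\<close>
  define B where "B k s \<longleftrightarrow> real (N (row k) k) / 2 ^ k \<le> third (Suc (sqrt_rest k)) \<or>
      \<not> real (N (row k) s) / 2 ^ s \<le> third (sqrt_rest k)" for k s
  have "recursive_rel 2 (\<lambda>xs. B (xs ! 0) (xs ! 1))"
    unfolding B_def approx_le_third_iff row_def
    by (intro recursive_intros N_rec recursive_sqrt_rest recursive_sqrt_floor) auto
  moreover have "B k t" if "B k s" "s \<le> t" for k s t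
    using that left_approx_mono[OF N \<open>s \<le> t\<close>, of "row k"] by (auto simp: B_def)
  ultimately obtain r where r: "left_re r" "\<And>k. odd \<lceil>4 ^ Suc k * r\<rceil> \<longleftrightarrow> (\<exists>s. B k s)"
    using left_re_coding by blast
  \<comment> \<open>Universality gives r an index n, and at this n the diagonal set reads r
    itself.\<close>
  have "r \<in> range \<alpha>"
    using assms(1) r(1) by (simp add: universal_left_re_numbering_def left_re_numbering_of_def)
  then obtain n where n: "\<alpha> n = r" by blast
  have diag: "n \<in> diagonal \<alpha> \<longleftrightarrow> (\<forall>k. sqrt_rest k = n \<longrightarrow> (\<exists>s. B k s))"
    using n r(2) by (simp add: diagonal_def)
  have "n \<in> diagonal \<alpha> \<longleftrightarrow> n \<notin> hits \<beta>"
  proof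
    assume n_diag: "n \<in> diagonal \<alpha>"
    show "n \<notin> hits \<beta>"
    proof
      assume "n \<in> hits \<beta>"
      then obtain e where e: "third (Suc n) < \<beta> e" "\<beta> e \<le> third n" by (auto simp: hits_def)
      obtain s0 where s0: "\<And>s. s0 \<le> s \<Longrightarrow> third (Suc n) < real (N e s) / 2 ^ s"
        using order_tendstoD(1)[OF N_lim e(1)] unfolding eventually_sequentially by blast
      \<comment> \<open>The code of n and e is chosen so late that stage k exceeds the lower bound;
        \<open>B k s\<close> could then only refute the upper bound, which e satisfies.\<close>
      obtain k where k: "s0 \<le> k" "sqrt_rest k = n" "row k = e"
        unfolding row_def using sqrt_rest_surj by blast
      then obtain s where "B k s" using n_diag diag by blast
      with k s0[of k] left_approx_le[OF N, of e s] e(2) show False by (simp add: B_def)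
    qed
  next
    assume not_hit: "n \<notin> hits \<beta>"
    have "\<exists>s. B k s" if "sqrt_rest k = n" for k
    proof (cases "real (N (row k) k) / 2 ^ k \<le> third (Suc n)")
      case True
      with that show ?thesis by (auto simp: B_def)
    next
      case False
      with left_approx_le[OF N, of "row k" k] have "third (Suc n) < \<beta> (row k)" by linarith
      with not_hit have "third n < \<beta> (row k)" by (auto simp: hits_def not_le)
      then obtain s where "third n < real (N (row k) s) / 2 ^ s"
        using order_tendstoD(1)[OF N_lim] unfolding eventually_sequentially by blast
      with that have "B k s" by (simp add: B_def)
      then show ?thesis by blast
    qed
    then show "n \<in> diagonal \<alpha>" using diag by blast
  qed
  then show ?thesis by blast
qed

text \<open>For given n, \<open>\<beta> e = third n\<close> and
  \<open>n \<in> diagonal \<alpha>\<close> are both of the form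
  \<open>\<forall>b. \<exists>c\<close>. When they hold, all large c work for a given b, so they can
  share b and c. The class stems from one \<alpha>, while \<beta> is any numbering.\<close>

lemma Sigma3_third_diagonal:
  assumes "left_re_numbering \<alpha>" "left_re_numbering \<beta>"
  shows "Sigma3 {e. \<beta> e \<in> third ` diagonal \<alpha>}"
proof -
  obtain N where N: "left_approx N \<alpha>" using left_re_numbering_approx[OF assms(1)] .
  obtain P where P: "left_approx P \<beta>" using left_re_numbering_approx[OF assms(2)] .
  note N_rec = recursive_comp2[where f = N, OF conjunct1[OF N[unfolded left_approx_def]]]
  note P_rec = recursive_comp2[where f = P, OF conjunct1[OF P[unfolded left_approx_def]]]
  have N_lim: "\<And>e. (\<lambda>s. real (N e s) / 2 ^ s) \<longlonglongrightarrow> \<alpha> e" using N by (simp add: left_approx_def)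
  have P_lim: "\<And>e. (\<lambda>s. real (P e s) / 2 ^ s) \<longlonglongrightarrow> \<beta> e" using P by (simp add: left_approx_def)
  \<comment> \<open>The second conjunct bounds \<beta> e by \<open>third n\<close> from above, the
    third from below up to \<open>1 / 2 ^ b\<close>. The last tests digit \<open>sqrt_rest b\<close>
    of \<alpha> n at stage c, which the first forces to be late.\<close>
  define R where "R e n b c \<longleftrightarrow> b \<le> c \<and> real (P e b) / 2 ^ b \<le> third n \<and>
      third n < real (P e c) / 2 ^ c + 1 / 2 ^ b \<and>
      (sqrt_rest (sqrt_rest b) = n \<longrightarrow> odd (ceiling_div (4 ^ Suc (sqrt_rest b) * N n c) (2 ^ c)))"
    for e n b c
  have rec: "recursive_rel 4 (\<lambda>xs. R (xs ! 0) (xs ! 1) (xs ! 2) (xs ! 3))"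
    unfolding R_def approx_le_third_iff third_less_approx_iff
    by (intro recursive_intros N_rec P_rec recursive_sqrt_rest recursive_ceiling_div) auto
  have odd_iff: "eventually (\<lambda>c. odd (ceiling_div (4 ^ Suc k * N n c) (2 ^ c)) \<longleftrightarrow>
      odd \<lceil>4 ^ Suc k * \<alpha> n\<rceil>) sequentially" for n k
  proof -
    have "eventually (\<lambda>c. \<lceil>4 ^ Suc k * (real (N n c) / 2 ^ c)\<rceil> = \<lceil>4 ^ Suc k * \<alpha> n\<rceil>) sequentially"
      using left_approx_le[OF N, of n]
      by (intro ceiling_eventually_eq tendsto_mult_left N_lim mult_left_mono) auto
    then show ?thesis
    proof eventually_elim
      case (elim c)
      have "int (ceiling_div (4 ^ Suc k * N n c) (2 ^ c)) = \<lceil>4 ^ Suc k * \<alpha> n\<rceil>"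
        using ceiling_div_eq[of "2 ^ c" "4 ^ Suc k * N n c"] elim by simp
      then show ?case by (metis even_of_nat)
    qed
  qed
  have "\<beta> e = third n \<and> n \<in> diagonal \<alpha> \<longleftrightarrow> (\<forall>b. \<exists>c. R e n b c)" for e n
  proof (intro iffI allI conjI)
    fix b assume hit: "\<beta> e = third n \<and> n \<in> diagonal \<alpha>"
    have "eventually (\<lambda>c. third n - 1 / 2 ^ b < real (P e c) / 2 ^ c) sequentially"
      using hit by (intro order_tendstoD(1)[OF P_lim]) simp
    with odd_iff[of "sqrt_rest b" n] eventually_ge_at_top[of b]
    have "eventually (\<lambda>c. R e n b c) sequentially"
    proof eventually_elim
      case (elim c)
      then show ?case
        using hit left_approx_le[OF P, of e b] by (auto simp: R_def diagonal_def)
    qed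
    then show "\<exists>c. R e n b c" by (rule eventually_happens'[OF sequentially_bot])
  next
    assume R: "\<forall>b. \<exists>c. R e n b c"
    show "\<beta> e = third n"
    proof (rule antisym)
      show "\<beta> e \<le> third n"
        using R by (intro LIMSEQ_le_const2[OF P_lim]) (auto simp: R_def)
      have "third n \<le> \<beta> e + (1/2) ^ b" for b
      proof -
        obtain c where "R e n b c" using R by blast
        with left_approx_le[OF P, of e c] show ?thesis by (simp add: R_def power_divide)
      qed
      moreover have "(\<lambda>b. \<beta> e + (1/2) ^ b) \<longlonglongrightarrow> \<beta> e + 0"
        by (intro tendsto_add tendsto_const LIMSEQ_realpow_zero) auto
      ultimately show "third n \<le> \<beta> e" by (intro LIMSEQ_le_const) auto
    qed
    show "n \<in> diagonal \<alpha>"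
      unfolding diagonal_def
    proof (intro CollectI allI impI)
      fix k assume k: "sqrt_rest k = n"
      obtain s where s: "\<And>c. s \<le> c \<Longrightarrow>
          odd (ceiling_div (4 ^ Suc k * N n c) (2 ^ c)) \<longleftrightarrow> odd \<lceil>4 ^ Suc k * \<alpha> n\<rceil>"
        using odd_iff[of k n] unfolding eventually_sequentially by blast
      \<comment> \<open>Each k is \<open>sqrt_rest b\<close> for arbitrarily large b, so some test
        of digit k takes place after the digit has settled.\<close>
      obtain b where b: "s \<le> b" "sqrt_rest b = k" using sqrt_rest_surj by blast
      obtain c where "R e n b c" using R by blast
      with b k s[of c] show "odd \<lceil>4 ^ Suc k * \<alpha> n\<rceil>" by (auto simp: R_def)
    qed
  qed
  then have "e \<in> {e. \<beta> e \<in> third ` diagonal \<alpha>} \<longleftrightarrow> (\<exists>n. \<forall>b. \<exists>c. R e n b c)" for e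
    by blast
  then show ?thesis
    unfolding Sigma3_def
    by (intro exI[of _ "\<lambda>xs. R (xs ! 0) (xs ! 1) (xs ! 2) (xs ! 3)"] conjI rec) simp
qed

text \<open>If no universal numbering existed, the \<open>\<Sigma>\<^sub>3\<close> condition would be void and a cardinality argument
  would do; this spares the construction of a universal numbering.\<close>

theorem theorem3p8:
  shows "\<exists>\<C> :: real set. \<C> \<noteq> {} \<and> (\<forall>x\<in>\<C>. left_re x \<and> infinite_real x) \<and>
    (\<forall>\<alpha>. universal_left_re_numbering \<alpha> \<longrightarrow> Sigma3 {e. \<alpha> e \<in> \<C>}) \<and>
    (\<nexists>x. shift_persistent \<C> x) \<and>
    (\<nexists>\<alpha>. left_re_numbering_of \<alpha> \<C>)"
proof -
  obtain A where not_hits: "\<And>\<beta>. left_re_numbering \<beta> \<Longrightarrow> A \<noteq> hits \<beta>"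
    and Sigma3: "\<And>\<beta>. universal_left_re_numbering \<beta> \<Longrightarrow> Sigma3 {e. \<beta> e \<in> third ` A}"
  proof (cases "\<exists>\<alpha>. universal_left_re_numbering \<alpha>")
    case True
    then obtain \<alpha> where \<alpha>: "universal_left_re_numbering \<alpha>" by blast
    show ?thesis
    proof (rule that[of "diagonal \<alpha>"])
      show "Sigma3 {e. \<beta> e \<in> third ` diagonal \<alpha>}" if "universal_left_re_numbering \<beta>" for \<beta>
        using \<alpha> that unfolding universal_left_re_numbering_def left_re_numbering_of_def
        by (blast intro: Sigma3_third_diagonal)
    qed (rule diagonal_not_hits[OF \<alpha>])
  next
    case False
    with ex_not_hits that show ?thesis by blast
  qed
  \<comment> \<open>A differs from the hits of the zero numbering, so it is nonempty.\<close>
  have "hits (\<lambda>_. 0) = {}"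
    using third_pos by (auto simp: hits_def not_less less_imp_le)
  with not_hits[OF left_re_numbering_zero] have "third ` A \<noteq> {}" by simp
  moreover have "\<not> shift_persistent (third ` A) x" for x
  proof
    assume "shift_persistent (third ` A) x"
    then obtain X where "binary_value X \<in> third ` A" "binary_value ([True] @- X) \<in> third ` A"
      unfolding shift_persistent_def by blast
    then obtain m n where "binary_value X = third m" "(1 + binary_value X) / 2 = third n"
      by (auto simp: binary_value_SCons)
    then show False using third_pos[of m] third_le[of n] by simp
  qed
  moreover have "\<not> left_re_numbering_of \<beta> (third ` A)" for \<beta>
  proof
    assume "left_re_numbering_of \<beta> (third ` A)"
    then have \<beta>: "left_re_numbering \<beta>" and range: "range \<beta> = third ` A"
      by (auto simp: left_re_numbering_of_def)
    \<comment> \<open>The intervals are disjoint and the n-th contains only \<open>third n\<close>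
      from the sequence, so the range of \<beta> determines A.\<close>
    have "hits \<beta> = (\<Union>x\<in>range \<beta>. {n. third (Suc n) < x \<and> x \<le> third n})"
      by (auto simp: hits_def)
    also have "\<dots> = A"
      unfolding range by (auto simp: third_less_iff third_le_iff less_Suc_eq_le dest: antisym)
    finally show False using not_hits[OF \<beta>] by simp
  qed
  ultimately show ?thesis
    using Sigma3 left_re_third infinite_real_third by (intro exI[of _ "third ` A"]) blast
qed

end
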